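(* Let $\lambda\in\mathbb{C}$ with $\lambda\neq 1$, let $r,k\in\mathbb{Z}$ and $n\geq 0$. Then \[ T_{n}^{(r,k)}(x|\lambda)=\sum_{m=0}^{n}\frac{1}{(m+1)^k}\sum_{j=0}^{m}(-1)^j \binom{m}{j}\sum_{l=0}^{n}\binom{n}{l}H_{n-l}^{(r)}(\lambda)(x-j)^{l}. \]
   Context: For $k\in\mathbb{Z}$, $Li_k(x)=\sum_{n\ge1}x^n/n^k$ (polylogarithm), so that $\frac{Li_k(1-e^{-t})}{1-e^{-t}}=\sum_{m\ge 0}\frac{(1-e^{-t})^m}{(m+1)^k}$ is a formal power series in $t$. The higher-order Frobenius-Euler and poly-Bernoulli mixed type polynomials $T_n^{(r,k)}(x|\lambda)$ are defined by the generating function $\left(\frac{1-\lambda}{e^t-\lambda}\right)^r\frac{Li_{k}(1-e^{-t})}{1-e^{-t}}e^{xt}=\sum_{n\ge0}T_n^{(r,k)}(x|\lambda)\frac{t^n}{n!}$. The Frobenius-Euler numbers of order $r$ are defined by $\left(\frac{1-\lambda}{e^t-\lambda}\right)^{r}=\sum_{n\ge0}H_n^{(r)}(\lambda)\frac{t^n}{n!}$. *)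

theory Defs
  imports Complex_Main "HOL-Computational_Algebra.Formal_Power_Series"
begin

definition polylog_fps :: "int \<Rightarrow> complex fps" where
  "polylog_fps k = Abs_fps (\<lambda>n. if n = 0 then 0 else 1 / (of_nat n powi k))"

text \<open>
  Both series in the quotient have zero constant term, and the denominator has subdegree 1,
  so the division of formal power series is exact here.
\<close>

definition poly_Bernoulli_fps :: "int \<Rightarrow> complex fps" where
  "poly_Bernoulli_fps k =
     (polylog_fps k oo (1 - fps_exp (- 1))) / (1 - fps_exp (- 1))"

text \<open>
  For \<^term>\<open>lam \<noteq> (1::complex)\<close> the base is an invertible power series, so that all integer
  powers of it are meaningful.
\<close>

definition Frobenius_Euler_fps :: "int \<Rightarrow> complex \<Rightarrow> complex fps" where
  "Frobenius_Euler_fps r lam = (fps_const (1 - lam) / (fps_exp 1 - fps_const lam)) powi r"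

definition Frobenius_Euler_number :: "int \<Rightarrow> nat \<Rightarrow> complex \<Rightarrow> complex" where
  "Frobenius_Euler_number r n lam = fact n * fps_nth (Frobenius_Euler_fps r lam) n"

definition mixed_T :: "int \<Rightarrow> int \<Rightarrow> nat \<Rightarrow> complex \<Rightarrow> complex \<Rightarrow> complex" where
  "mixed_T r k n x lam =
     fact n * fps_nth (Frobenius_Euler_fps r lam * poly_Bernoulli_fps k * fps_exp x) n"

lemma Frobenius_Euler_number_generating_function:
  "Frobenius_Euler_fps r lam = Abs_fps (\<lambda>n. Frobenius_Euler_number r n lam / fact n)"
  by (simp add: fps_eq_iff Frobenius_Euler_number_def)

lemma mixed_T_generating_function:
  "Frobenius_Euler_fps r lam * poly_Bernoulli_fps k * fps_exp x =
     Abs_fps (\<lambda>n. mixed_T r k n x lam / fact n)"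
  by (simp add: fps_eq_iff mixed_T_def)

lemma poly_Bernoulli_fps_mult:
  "poly_Bernoulli_fps k * (1 - fps_exp (- 1)) = polylog_fps k oo (1 - fps_exp (- 1))"
proof -
  let ?u = "1 - fps_exp (- 1) :: complex fps" and ?v = "polylog_fps k oo (1 - fps_exp (- 1))"
  have u1: "fps_nth ?u 1 \<noteq> 0"
    by simp
  have u: "?u \<noteq> 0"
  proof
    assume "?u = 0"
    hence "fps_nth ?u 1 = fps_nth 0 1"
      by (rule arg_cong)
    also have "fps_nth (0 :: complex fps) 1 = 0"
      by (rule fps_zero_nth)
    finally show False
      using u1 by (rule notE[rotated])
  qed
  have le: "subdegree ?u \<le> 1"
    using u1 by (rule subdegree_leI)
  have v0: "fps_nth ?v 0 = 0"
    by (simp add: polylog_fps_def)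
  have "?u dvd ?v"
  proof (cases "?v = 0")
    case False
    hence "fps_nth ?v (subdegree ?v) \<noteq> 0"
      by (rule nth_subdegree_nonzero)
    hence "subdegree ?v \<noteq> 0"
      using v0 by metis
    hence "subdegree ?u \<le> subdegree ?v"
      using le by linarith
    thus ?thesis
      using fps_dvd_iff[OF u False] by blast
  next
    case True
    show ?thesis
      unfolding True by (rule dvd_0_right)
  qed
  thus ?thesis
    unfolding poly_Bernoulli_fps_def by (rule dvd_div_mult_self)
qed

end

theory Submission
  imports Defs
begin

text \<open>
  Writing $u = 1 - e^{-t}$, one has $Li_k(u)/u = \sum_m u^m/(m+1)^k$. As $u$ has no constant
  term, only $m \le n$ contributes to the coefficient of $t^n$. The binomial theorem turns
  $u^m e^{xt}$ into $\sum_j (-1)^j \binom{m}{j} e^{(x-j)t}$, and the remaining product with the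
  Frobenius-Euler series is a binomial convolution.
\<close>

text \<open>The polylogarithm series is \<open>fps_X\<close> times the series with coefficients
  \<open>1 / (m + 1)^k\<close>. Substitution respects products, so it yields a factor
  \<open>1 - fps_exp (- 1)\<close> that cancels the denominator.\<close>

lemma poly_Bernoulli_fps_eq_compose:
  "poly_Bernoulli_fps k = Abs_fps (\<lambda>m. 1 / (of_nat (m + 1) powi k)) oo (1 - fps_exp (- 1))"
proof -
  let ?u = "1 - fps_exp (- 1) :: complex fps"
  let ?A = "Abs_fps (\<lambda>m. 1 / (of_nat (m + 1) powi k)) :: complex fps"
  have u0: "fps_nth ?u 0 = 0"
    by simp
  \<comment> \<open>The coefficient of \<open>t\<close> in \<open>?u\<close> is 1, so
    \<open>?u\<close> is nonzero and may be cancelled.\<close>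
  have "fps_nth ?u 1 \<noteq> 0"
    by simp
  hence u: "?u \<noteq> 0"
    by (metis fps_zero_nth)
  have "polylog_fps k = fps_X * ?A"
    by (rule fps_ext) (simp add: polylog_fps_def)
  hence "polylog_fps k oo ?u = (?A oo ?u) * ?u"
    by (simp add: fps_compose_mult_distrib[OF u0] fps_X_fps_compose_startby0[OF u0] mult.commute)
  thus ?thesis
    using u unfolding poly_Bernoulli_fps_def by (metis nonzero_mult_div_cancel_right)
qed

text \<open>Since \<open>u\<close> has no constant term, \<open>u ^ m\<close> starts at degree
  \<open>m\<close> or later, so powers beyond \<open>n\<close> do not reach the coefficient of index
  \<open>n\<close>.\<close>

lemma fps_nth_mult_compose:
  fixes F A u :: "'a :: comm_ring_1 fps"
  assumes "fps_nth u 0 = 0"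
  shows "fps_nth (F * (A oo u)) n = (\<Sum>m=0..n. fps_nth A m * fps_nth (F * u ^ m) n)"
proof -
  \<comment> \<open>The range \<open>0..i\<close> given by composition is padded with zero terms up
    to \<open>0..n\<close>. A bound independent of \<open>i\<close> is what allows the two sums to
    be swapped.\<close>
  have "fps_nth (A oo u) i = (\<Sum>m=0..n. fps_nth A m * fps_nth (u ^ m) i)" if "i \<le> n" for i
    unfolding fps_compose_nth
    by (rule sum.mono_neutral_left) (use that assms in \<open>auto simp: startsby_zero_power_prefix\<close>)
  hence "fps_nth (F * (A oo u)) n =
      (\<Sum>i=0..n. \<Sum>m=0..n. fps_nth A m * (fps_nth F (n - i) * fps_nth (u ^ m) i))"
    unfolding mult.commute[of F] fps_mult_nth
    by (simp add: sum_distrib_left sum_distrib_right mult_ac)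
  also have "\<dots> = (\<Sum>m=0..n. fps_nth A m * (\<Sum>i=0..n. fps_nth F (n - i) * fps_nth (u ^ m) i))"
    by (subst sum.swap) (simp add: sum_distrib_left)
  also have "\<dots> = (\<Sum>m=0..n. fps_nth A m * fps_nth (u ^ m * F) n)"
    unfolding fps_mult_nth by (simp only: mult.commute)
  finally show ?thesis
    by (simp add: mult.commute)
qed

lemma one_minus_fps_exp_power:
  "(1 - fps_exp (- 1) :: 'a :: field_char_0 fps) ^ m =
     (\<Sum>j=0..m. fps_const ((- 1) ^ j * of_nat (m choose j)) * fps_exp (- of_nat j))"
proof -
  \<comment> \<open>\<open>binomial_ring\<close> puts the exponent \<open>j\<close> on the first
    summand, so the exponential is moved to the front.\<close>
  have "(1 - fps_exp (- 1) :: 'a fps) ^ m = (- fps_exp (- 1) + 1) ^ m"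
    by simp
  also have "\<dots> = (\<Sum>j\<le>m. of_nat (m choose j) * (- fps_exp (- 1)) ^ j * 1 ^ (m - j))"
    by (rule binomial_ring)
  also have "\<dots> = (\<Sum>j=0..m. fps_const ((- 1) ^ j * of_nat (m choose j)) * fps_exp (- of_nat j))"
  proof (rule sum.cong)
    fix j
    have "(- fps_exp (- 1) :: 'a fps) ^ j = fps_const ((- 1) ^ j) * fps_exp (- of_nat j)"
      by (subst power_minus)
        (simp add: fps_exp_power_mult flip: fps_const_power fps_const_neg)
    thus "of_nat (m choose j) * (- fps_exp (- 1)) ^ j * 1 ^ (m - j) =
        fps_const ((- 1) ^ j * of_nat (m choose j)) * fps_exp (- of_nat j :: 'a)"
      by (simp add: mult_ac flip: fps_of_nat fps_const_mult)
  qed auto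
  finally show ?thesis .
qed

text \<open>The factor \<open>fact n\<close> turns the Cauchy product of two exponential generating
  functions into a binomial convolution, as \<open>n! / (l! (n - l)!)\<close> is the binomial
  coefficient.\<close>

lemma fps_nth_Frobenius_Euler_mult_exp:
  "fact n * fps_nth (Frobenius_Euler_fps r lam * fps_exp y) n =
     (\<Sum>l=0..n. of_nat (n choose l) * Frobenius_Euler_number r (n - l) lam * y ^ l)"
proof -
  have "fact n * fps_nth (fps_exp y * Frobenius_Euler_fps r lam) n =
      (\<Sum>l=0..n. of_nat (n choose l) * Frobenius_Euler_number r (n - l) lam * y ^ l)"
    unfolding fps_mult_nth sum_distrib_left
    by (rule sum.cong) (auto simp: Frobenius_Euler_number_def binomial_fact field_simps)
  thus ?thesis
    by (simp add: mult.commute)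
qed

theorem theorem1:
  fixes lam x :: complex and r k :: int and n :: nat
  assumes "lam \<noteq> 1"
  shows "mixed_T r k n x lam =
    (\<Sum>m=0..n. 1 / (of_nat (m + 1) powi k) *
      (\<Sum>j=0..m. (- 1) ^ j * of_nat (m choose j) *
        (\<Sum>l=0..n. of_nat (n choose l) * Frobenius_Euler_number r (n - l) lam *
          (x - of_nat j) ^ l)))"
proof -
  let ?F = "Frobenius_Euler_fps r lam"
  let ?u = "1 - fps_exp (- 1) :: complex fps"
  have expand: "?F * fps_exp x * ?u ^ m =
      (\<Sum>j=0..m. fps_const ((- 1) ^ j * of_nat (m choose j)) * (?F * fps_exp (x - of_nat j)))" for m
  proof -
    have "fps_exp (x - of_nat j) = fps_exp x * fps_exp (- of_nat j)" for j
      by (simp flip: fps_exp_add_mult)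
    thus ?thesis
      by (simp add: one_minus_fps_exp_power sum_distrib_left mult_ac)
  qed
  \<comment> \<open>The composed factor goes last, so that \<open>?F * fps_exp x\<close> as a whole
    takes the role of \<open>F\<close> in \<open>fps_nth_mult_compose\<close>.\<close>
  have "mixed_T r k n x lam = fact n * fps_nth (?F * fps_exp x * poly_Bernoulli_fps k) n"
    by (simp add: mixed_T_def mult_ac)
  also have "\<dots> = (\<Sum>m=0..n. 1 / (of_nat (m + 1) powi k) *
      (fact n * fps_nth (?F * fps_exp x * ?u ^ m) n))"
    unfolding poly_Bernoulli_fps_eq_compose
    by (subst fps_nth_mult_compose) (simp_all add: sum_distrib_left mult_ac)
  also have "\<dots> = (\<Sum>m=0..n. 1 / (of_nat (m + 1) powi k) *
      (\<Sum>j=0..m. (- 1) ^ j * of_nat (m choose j) *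
        (fact n * fps_nth (?F * fps_exp (x - of_nat j)) n)))"
    unfolding expand fps_sum_nth fps_mult_left_const_nth
    by (simp only: sum_distrib_left mult_ac)
  finally show ?thesis
    unfolding fps_nth_Frobenius_Euler_mult_exp .
qed

end
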